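(* If $R$ is a UQ ring and $G$ is a locally finite $2$-group, then the group ring $RG$ is a UQ ring.
   Context: Rings are associative with identity, not necessarily commutative. $U(S)$ is the group of units of a ring $S$. An element $a\in S$ is quasinilpotent if $1-ax\in U(S)$ for every $x\in S$ with $ax=xa$; $QN(S)$ is the set of quasinilpotent elements. A ring $S$ is UQ if $U(S)=1+QN(S)$. A $2$-group is a (possibly infinite) group in which every element has finite order equal to a power of $2$; a group is locally finite if each of its finitely generated subgroups is finite. *)

theory Defs
  imports "HOL-Algebra.Generated_Groups" "HOL-Algebra.Multiplicative_Group"
begin

definition quasinilpotents :: "('a, 'm) ring_scheme \<Rightarrow> 'a set" where
  "quasinilpotents S =
     {a \<in> carrier S. \<forall>x \<in> carrier S.
        a \<otimes>\<^bsub>S\<^esub> x = x \<otimes>\<^bsub>S\<^esub> a \<longrightarrow> \<one>\<^bsub>S\<^esub> \<ominus>\<^bsub>S\<^esub> a \<otimes>\<^bsub>S\<^esub> x \<in> Units S}"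

definition UQ_ring :: "('a, 'm) ring_scheme \<Rightarrow> bool" where
  "UQ_ring S \<longleftrightarrow> ring S \<and> Units S = (\<lambda>q. \<one>\<^bsub>S\<^esub> \<oplus>\<^bsub>S\<^esub> q) ` quasinilpotents S"

text \<open>
  In the library \<^const>\<open>group.ord\<close> is 0 for elements of infinite order,
  so the condition below forces every element to have finite order.
\<close>

definition two_group :: "('g, 'n) monoid_scheme \<Rightarrow> bool" where
  "two_group G \<longleftrightarrow> group G \<and> (\<forall>x \<in> carrier G. \<exists>k::nat. group.ord G x = 2 ^ k)"

definition locally_finite_group :: "('g, 'n) monoid_scheme \<Rightarrow> bool" where
  "locally_finite_group G \<longleftrightarrow>
     group G \<and> (\<forall>A. A \<subseteq> carrier G \<longrightarrow> finite A \<longrightarrow> finite (generate G A))"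

definition group_ring_supp ::
  "('a, 'm) ring_scheme \<Rightarrow> ('g, 'n) monoid_scheme \<Rightarrow> ('g \<Rightarrow> 'a) \<Rightarrow> 'g set" where
  "group_ring_supp R G f = {g \<in> carrier G. f g \<noteq> \<zero>\<^bsub>R\<^esub>}"

text \<open>
  A formal sum \<open>\<Sum>g. f(g) g\<close> is represented by its coefficient function, which is
  \<^const>\<open>undefined\<close> outside the carrier of the group (extensionality makes equality of
  formal sums the equality of functions).  The product is convolution,
  \<open>(f h)(g) = \<Sum>x. f(x) h(x\<inverse> g)\<close>; the sum is restricted to the support of \<open>f\<close>
  because \<^const>\<open>finsum\<close> over an infinite set is zero by convention.
\<close>

definition group_ring ::
  "('a, 'm) ring_scheme \<Rightarrow> ('g, 'n) monoid_scheme \<Rightarrow> ('g \<Rightarrow> 'a) ring" where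
  "group_ring R G =
     \<lparr> carrier = {f \<in> carrier G \<rightarrow>\<^sub>E carrier R. finite (group_ring_supp R G f)},
       mult = (\<lambda>f h. \<lambda>g\<in>carrier G.
          \<Oplus>\<^bsub>R\<^esub>x\<in>group_ring_supp R G f. f x \<otimes>\<^bsub>R\<^esub> h (inv\<^bsub>G\<^esub> x \<otimes>\<^bsub>G\<^esub> g)),
       one = (\<lambda>g\<in>carrier G. if g = \<one>\<^bsub>G\<^esub> then \<one>\<^bsub>R\<^esub> else \<zero>\<^bsub>R\<^esub>),
       zero = (\<lambda>g\<in>carrier G. \<zero>\<^bsub>R\<^esub>),
       add = (\<lambda>f h. \<lambda>g\<in>carrier G. f g \<oplus>\<^bsub>R\<^esub> h g) \<rparr>"

end

theory Submission
  imports Defs "HOL-Algebra.Subrings" "HOL-Algebra.Sylow"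
begin

text \<open>
  If a ring homomorphism \<open>\<epsilon> : S \<rightarrow> R\<close> reflects units and \<open>R\<close> is UQ, then \<open>S\<close> is UQ: for a unit \<open>u\<close> of \<open>S\<close>
  the element \<open>\<epsilon>(u) - 1\<close> is quasinilpotent, and \<open>\<epsilon>(1 - (u - 1) x)\<close> is then a unit whenever \<open>x\<close>
  commutes with \<open>u - 1\<close>. So it suffices that the augmentation of \<open>R G\<close> reflects units.

  In a UQ ring \<open>-1 = 1 + q\<close> with \<open>q = -2\<close> quasinilpotent and central, so \<open>1 - 2 x\<close> is always a unit.
  By local finiteness an element of \<open>R G\<close> lives over a finite subgroup \<open>H\<close> of order \<open>2\<^sup>n\<close>, and Sylow's
  theorem gives a subgroup \<open>K\<close> of index 2. Induction on \<open>n\<close> passes from \<open>R K\<close> to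
  \<open>R H = R K + R K t\<close> by multiplying with conjugates such as \<open>1 - b (t - 1)\<close>, which needs only
  that the elements of \<open>1 + 2 R\<close> are units.
\<close>

subsection \<open>Units and quasinilpotents\<close>

text \<open>With \<open>z\<close> the inverse of \<open>x y\<close>, the element \<open>y z\<close>
  is a right inverse of \<open>x\<close>. Because \<open>y x = x y\<close>, the element
  \<open>z y\<close> is a left inverse. One-sided inverses on both sides must coincide.\<close>

lemma (in monoid) Units_of_commuting_product:
  assumes "x \<in> carrier G" "y \<in> carrier G" "x \<otimes> y = y \<otimes> x" "x \<otimes> y \<in> Units G"
  shows "x \<in> Units G"
proof -
  let ?z = "inv (x \<otimes> y)"
  have z: "?z \<in> carrier G" using assms by simp
  have r: "x \<otimes> (y \<otimes> ?z) = \<one>" using assms z by (simp add: m_assoc [symmetric])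
  have l: "(?z \<otimes> y) \<otimes> x = \<one>" using assms z by (simp add: m_assoc)
  have "y \<otimes> ?z = ?z \<otimes> y"
    using inv_unique [of "?z \<otimes> y" x "y \<otimes> ?z"] assms z r l by simp
  with r l z assms show ?thesis unfolding Units_def by auto
qed

text \<open>The commuting factors 1 + p and 1 - p multiply to 1 - p^2. This trades p for p^2, which
  is useful below because squaring pushes \<open>c t\<close> into the subring \<open>A\<close> and
  turns \<open>b (t - 1)\<close> into something that is even modulo the kernel of
  \<open>e\<close>.\<close>

lemma (in ring) Units_one_plus:
  assumes "p \<in> carrier R" "\<one> \<ominus> p \<otimes> p \<in> Units R"
  shows "\<one> \<oplus> p \<in> Units R"
proof (rule Units_of_commuting_product)
  have "(\<one> \<oplus> p) \<otimes> (\<one> \<ominus> p) = (\<one> \<ominus> p) \<oplus> (p \<ominus> p \<otimes> p)"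
    using assms(1) by (simp add: l_distr) (simp add: r_distr minus_eq r_minus)
  also have "\<dots> = \<one> \<ominus> p \<otimes> p" using assms(1) by algebra
  finally have "(\<one> \<oplus> p) \<otimes> (\<one> \<ominus> p) = \<one> \<ominus> p \<otimes> p" .
  then show "(\<one> \<oplus> p) \<otimes> (\<one> \<ominus> p) \<in> Units R" using assms(2) by simp
  show "(\<one> \<oplus> p) \<otimes> (\<one> \<ominus> p) = (\<one> \<ominus> p) \<otimes> (\<one> \<oplus> p)" using assms(1) by (simp add: ring_simprules)
qed (use assms(1) in auto)

lemma UQ_ring_two_in_radical:
  fixes R (structure)
  assumes "UQ_ring R" and x: "x \<in> carrier R"
  shows "\<one> \<ominus> (x \<oplus> x) \<in> Units R"
proof -
  interpret ring R using assms by (simp add: UQ_ring_def)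
  have "\<ominus> \<one> \<in> Units R" unfolding Units_def by (auto intro!: bexI [of _ "\<ominus> \<one>"] simp: l_minus)
  then obtain q where q: "q \<in> quasinilpotents R" "\<ominus> \<one> = \<one> \<oplus> q"
    using assms by (auto simp: UQ_ring_def)
  then have qc: "q \<in> carrier R" by (simp add: quasinilpotents_def)
  have "q = \<ominus> \<one> \<oplus> (\<one> \<oplus> q)" using qc by algebra
  also have "\<dots> = \<ominus> (\<one> \<oplus> \<one>)" using q(2)[symmetric] by (simp add: minus_add)
  finally have q': "q = \<ominus> (\<one> \<oplus> \<one>)" .
  \<comment> \<open>As -2 is central, its quasinilpotence can be tested on an arbitrary element; the
    choice -x gives 1 - (-2)(-x) = 1 - 2x.\<close>
  have "q \<otimes> (\<ominus> x) = (\<ominus> x) \<otimes> q" unfolding q' using x by (simp add: ring_simprules)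
  then have "\<one> \<ominus> q \<otimes> (\<ominus> x) \<in> Units R" using q(1) x by (simp add: quasinilpotents_def)
  moreover have "\<one> \<ominus> q \<otimes> (\<ominus> x) = \<one> \<ominus> (x \<oplus> x)" unfolding q' using x by (simp add: ring_simprules)
  ultimately show ?thesis by simp
qed

lemma UQ_ring_lift:
  assumes S: "ring S" and R: "UQ_ring R" and e: "e \<in> ring_hom S R"
    and lift: "\<And>f. f \<in> carrier S \<Longrightarrow> e f \<in> Units R \<Longrightarrow> f \<in> Units S"
  shows "UQ_ring S"
proof -
  interpret S: ring S by fact
  interpret R: ring R using R by (simp add: UQ_ring_def)
  interpret e: ring_hom_ring S R e using e by (intro ring_hom_ringI2 S.ring_axioms R.ring_axioms)
  have eminus: "e (x \<ominus>\<^bsub>S\<^esub> y) = e x \<ominus>\<^bsub>R\<^esub> e y" if "x \<in> carrier S" "y \<in> carrier S" for x y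
    using that by (simp add: a_minus_def)
  have "Units S = (\<lambda>q. \<one>\<^bsub>S\<^esub> \<oplus>\<^bsub>S\<^esub> q) ` quasinilpotents S"
  proof (intro equalityI subsetI)
    fix u assume u: "u \<in> Units S"
    then have uS: "u \<in> carrier S" by (rule S.Units_closed)
    let ?q = "u \<ominus>\<^bsub>S\<^esub> \<one>\<^bsub>S\<^esub>"
    obtain v where "v \<in> carrier S" "u \<otimes>\<^bsub>S\<^esub> v = \<one>\<^bsub>S\<^esub>" "v \<otimes>\<^bsub>S\<^esub> u = \<one>\<^bsub>S\<^esub>"
      using u by (auto simp: Units_def)
    then have "e v \<in> carrier R" "e u \<otimes>\<^bsub>R\<^esub> e v = \<one>\<^bsub>R\<^esub>" "e v \<otimes>\<^bsub>R\<^esub> e u = \<one>\<^bsub>R\<^esub>"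
      using uS by (auto simp flip: e.hom_mult)
    then have "e u \<in> Units R" using uS unfolding Units_def by auto
    then obtain r where r: "r \<in> quasinilpotents R" "e u = \<one>\<^bsub>R\<^esub> \<oplus>\<^bsub>R\<^esub> r"
      using R by (auto simp: UQ_ring_def)
    then have rc: "r \<in> carrier R" by (simp add: quasinilpotents_def)
    have eq: "e ?q = r" using uS r(2) rc by (simp add: eminus R.minus_eq R.a_ac R.r_neg)
    have "?q \<in> quasinilpotents S" unfolding quasinilpotents_def
    proof (intro CollectI conjI ballI impI)
      show qS: "?q \<in> carrier S" using uS by simp
      fix x assume x: "x \<in> carrier S" and "?q \<otimes>\<^bsub>S\<^esub> x = x \<otimes>\<^bsub>S\<^esub> ?q"
      then have "r \<otimes>\<^bsub>R\<^esub> e x = e x \<otimes>\<^bsub>R\<^esub> r" using eq qS by (metis e.hom_mult)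
      then have "\<one>\<^bsub>R\<^esub> \<ominus>\<^bsub>R\<^esub> r \<otimes>\<^bsub>R\<^esub> e x \<in> Units R" using r(1) x by (simp add: quasinilpotents_def)
      moreover have "e (\<one>\<^bsub>S\<^esub> \<ominus>\<^bsub>S\<^esub> ?q \<otimes>\<^bsub>S\<^esub> x) = \<one>\<^bsub>R\<^esub> \<ominus>\<^bsub>R\<^esub> r \<otimes>\<^bsub>R\<^esub> e x"
        using x qS eq by (subst eminus) auto
      ultimately show "\<one>\<^bsub>S\<^esub> \<ominus>\<^bsub>S\<^esub> ?q \<otimes>\<^bsub>S\<^esub> x \<in> Units S" using x qS by (intro lift) auto
    qed
    moreover have "u = \<one>\<^bsub>S\<^esub> \<oplus>\<^bsub>S\<^esub> ?q" using uS by (simp add: S.minus_eq S.a_ac S.r_neg)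
    ultimately show "u \<in> (\<lambda>q. \<one>\<^bsub>S\<^esub> \<oplus>\<^bsub>S\<^esub> q) ` quasinilpotents S" by blast
  next
    fix u assume "u \<in> (\<lambda>q. \<one>\<^bsub>S\<^esub> \<oplus>\<^bsub>S\<^esub> q) ` quasinilpotents S"
    then obtain q where q: "q \<in> quasinilpotents S" "u = \<one>\<^bsub>S\<^esub> \<oplus>\<^bsub>S\<^esub> q" by blast
    then have qS: "q \<in> carrier S" by (simp add: quasinilpotents_def)
    \<comment> \<open>The reverse inclusion is general: testing quasinilpotence of q on -1 yields
      the unit 1 + q.\<close>
    have "q \<otimes>\<^bsub>S\<^esub> (\<ominus>\<^bsub>S\<^esub> \<one>\<^bsub>S\<^esub>) = (\<ominus>\<^bsub>S\<^esub> \<one>\<^bsub>S\<^esub>) \<otimes>\<^bsub>S\<^esub> q" using qS by (simp add: S.l_minus S.r_minus)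
    then have "\<one>\<^bsub>S\<^esub> \<ominus>\<^bsub>S\<^esub> q \<otimes>\<^bsub>S\<^esub> (\<ominus>\<^bsub>S\<^esub> \<one>\<^bsub>S\<^esub>) \<in> Units S" using q(1) by (simp add: quasinilpotents_def)
    then show "u \<in> Units S" using q(2) qS by (simp add: S.r_minus S.minus_eq)
  qed
  then show ?thesis using S by (simp add: UQ_ring_def)
qed

text \<open>
  An element \<open>a + b t\<close> equals \<open>s (1 + s\<inverse> b (t - 1))\<close> with \<open>s = a + b\<close>, so it suffices to treat
  \<open>1 + p\<close> with \<open>p = b (t - 1)\<close>. Here \<open>1 - p\<^sup>2 = u + v t\<close> with \<open>e u \<in> 1 + 2 R\<close> and \<open>e v \<in> 2 R\<close>; dividing by \<open>u\<close>
  leaves \<open>1 + c t\<close> with \<open>e c \<in> 2 R\<close>, and \<open>1 - (c t)\<^sup>2\<close> lies in \<open>A\<close> with image in \<open>1 + 2 R\<close>.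
\<close>

lemma Units_lift_index_two:
  fixes T (structure) and R (structure)
  assumes "ring T" "ring R" and e: "e \<in> ring_hom T R" and A: "subring A T"
    and two: "\<And>x. x \<in> carrier R \<Longrightarrow> \<one>\<^bsub>R\<^esub> \<ominus>\<^bsub>R\<^esub> (x \<oplus>\<^bsub>R\<^esub> x) \<in> Units R"
    and t: "t \<in> carrier T" "e t = \<one>\<^bsub>R\<^esub>" "t \<otimes>\<^bsub>T\<^esub> t \<in> A"
    and conj: "\<And>a. a \<in> A \<Longrightarrow> \<exists>a'\<in>A. t \<otimes>\<^bsub>T\<^esub> a = a' \<otimes>\<^bsub>T\<^esub> t"
    and dec: "\<And>f. f \<in> carrier T \<Longrightarrow> \<exists>a\<in>A. \<exists>b\<in>A. f = a \<oplus>\<^bsub>T\<^esub> b \<otimes>\<^bsub>T\<^esub> t"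
    and lift: "\<And>a. a \<in> A \<Longrightarrow> e a \<in> Units R \<Longrightarrow> a \<in> Units (T\<lparr>carrier := A\<rparr>)"
    and f: "f \<in> carrier T" "e f \<in> Units R"
  shows "f \<in> Units T"
proof -
  interpret T: ring T by fact
  interpret R: ring R by fact
  interpret e: ring_hom_ring T R e using e by (intro ring_hom_ringI2 assms(1,2))
  note Ac = subringE(1) [OF A, THEN subsetD]
  note Asub = subringE(2,3,5-7) [OF A]
  have Aminus: "x \<ominus>\<^bsub>T\<^esub> y \<in> A" if "x \<in> A" "y \<in> A" for x y
    using that Asub by (simp add: a_minus_def)
  have eminus: "e (x \<ominus>\<^bsub>T\<^esub> y) = e x \<ominus>\<^bsub>R\<^esub> e y" if "x \<in> carrier T" "y \<in> carrier T" for x y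
    using that by (simp add: a_minus_def)
  \<comment> \<open>Since \<open>e t\<close> is 1, moving \<open>t\<close> past an element of
    \<open>A\<close> does not change its image in \<open>R\<close>. This is what makes the images
    computed below squares and doubles.\<close>
  have conj': "\<exists>a'\<in>A. t \<otimes>\<^bsub>T\<^esub> a = a' \<otimes>\<^bsub>T\<^esub> t \<and> e a' = e a" if a: "a \<in> A" for a
  proof -
    obtain a' where a': "a' \<in> A" "t \<otimes>\<^bsub>T\<^esub> a = a' \<otimes>\<^bsub>T\<^esub> t" using conj a by blast
    then have "e t \<otimes>\<^bsub>R\<^esub> e a = e a' \<otimes>\<^bsub>R\<^esub> e t"
      using Ac [OF a] Ac [OF a'(1)] t by (metis e.hom_mult)
    then have "e a' = e a" using Ac [OF a] Ac [OF a'(1)] t by simp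
    with a' show ?thesis by blast
  qed
  have one_plus: "\<one>\<^bsub>T\<^esub> \<oplus>\<^bsub>T\<^esub> c \<otimes>\<^bsub>T\<^esub> t \<in> Units T"
    if c: "c \<in> A" and ec: "e c = y \<oplus>\<^bsub>R\<^esub> y" and y: "y \<in> carrier R" for c y
  proof (rule T.Units_one_plus)
    obtain c' where c': "c' \<in> A" "t \<otimes>\<^bsub>T\<^esub> c = c' \<otimes>\<^bsub>T\<^esub> t" "e c' = e c" using conj' c by blast
    note cc = Ac [OF c] Ac [OF c'(1)]
    show "c \<otimes>\<^bsub>T\<^esub> t \<in> carrier T" using cc t by simp
    have "(c \<otimes>\<^bsub>T\<^esub> t) \<otimes>\<^bsub>T\<^esub> (c \<otimes>\<^bsub>T\<^esub> t) = c \<otimes>\<^bsub>T\<^esub> (t \<otimes>\<^bsub>T\<^esub> c) \<otimes>\<^bsub>T\<^esub> t" using cc t by (simp add: T.m_assoc)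
    \<comment> \<open>Both occurrences of \<open>t\<close> are collected into t^2, which lies in
      \<open>A\<close>; hence \<open>?g\<close> lies in \<open>A\<close> and \<open>lift\<close> can
      be applied to it.\<close>
    then have sq: "(c \<otimes>\<^bsub>T\<^esub> t) \<otimes>\<^bsub>T\<^esub> (c \<otimes>\<^bsub>T\<^esub> t) = c \<otimes>\<^bsub>T\<^esub> c' \<otimes>\<^bsub>T\<^esub> (t \<otimes>\<^bsub>T\<^esub> t)" using cc t c' by (simp add: T.m_assoc)
    let ?g = "\<one>\<^bsub>T\<^esub> \<ominus>\<^bsub>T\<^esub> c \<otimes>\<^bsub>T\<^esub> c' \<otimes>\<^bsub>T\<^esub> (t \<otimes>\<^bsub>T\<^esub> t)"
    have gA: "?g \<in> A" using c c' t Asub Aminus by simp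
    have "e ?g = \<one>\<^bsub>R\<^esub> \<ominus>\<^bsub>R\<^esub> (y \<oplus>\<^bsub>R\<^esub> y) \<otimes>\<^bsub>R\<^esub> (y \<oplus>\<^bsub>R\<^esub> y)"
      using cc t c' ec y by (simp add: eminus)
    \<comment> \<open>The square of 2y is written as w + w with w = y(2y), the shape that
      \<open>two\<close> expects.\<close>
    also have "\<dots> = \<one>\<^bsub>R\<^esub> \<ominus>\<^bsub>R\<^esub> (y \<otimes>\<^bsub>R\<^esub> (y \<oplus>\<^bsub>R\<^esub> y) \<oplus>\<^bsub>R\<^esub> y \<otimes>\<^bsub>R\<^esub> (y \<oplus>\<^bsub>R\<^esub> y))"
      using y by (simp add: R.l_distr)
    also have "\<dots> \<in> Units R" using y by (intro two) simp
    finally have "?g \<in> Units (T\<lparr>carrier := A\<rparr>)" using lift gA by blast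
    then have "?g \<in> Units T" using Ac by (auto simp: Units_def)
    then show "\<one>\<^bsub>T\<^esub> \<ominus>\<^bsub>T\<^esub> (c \<otimes>\<^bsub>T\<^esub> t) \<otimes>\<^bsub>T\<^esub> (c \<otimes>\<^bsub>T\<^esub> t) \<in> Units T" by (simp add: sq)
  qed
  have even: "a \<oplus>\<^bsub>T\<^esub> b \<otimes>\<^bsub>T\<^esub> t \<in> Units T"
    if a: "a \<in> A" "e a \<in> Units R" and b: "b \<in> A" and eb: "e b = y \<oplus>\<^bsub>R\<^esub> y" and y: "y \<in> carrier R" for a b y
  proof -
    \<comment> \<open>The inverse is found inside \<open>A\<close>, so that \<open>a' b\<close>
      stays in \<open>A\<close>. Its image is again a double, and \<open>one_plus\<close> applies to
      the second factor of a + bt = a(1 + a'bt).\<close>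
    obtain a' where a': "a' \<in> A" "a \<otimes>\<^bsub>T\<^esub> a' = \<one>\<^bsub>T\<^esub>" "a' \<otimes>\<^bsub>T\<^esub> a = \<one>\<^bsub>T\<^esub>"
      using lift [OF a] by (auto simp: Units_def)
    note c = Ac [OF a(1)] Ac [OF a'(1)] Ac [OF b]
    have aU: "a \<in> Units T" using a' c unfolding Units_def by auto
    have "e (a' \<otimes>\<^bsub>T\<^esub> b) = e a' \<otimes>\<^bsub>R\<^esub> y \<oplus>\<^bsub>R\<^esub> e a' \<otimes>\<^bsub>R\<^esub> y" using c y eb by (simp add: R.r_distr)
    then have "\<one>\<^bsub>T\<^esub> \<oplus>\<^bsub>T\<^esub> (a' \<otimes>\<^bsub>T\<^esub> b) \<otimes>\<^bsub>T\<^esub> t \<in> Units T"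
      using a' b Asub c y by (intro one_plus [of _ "e a' \<otimes>\<^bsub>R\<^esub> y"]) auto
    then have "a \<otimes>\<^bsub>T\<^esub> (\<one>\<^bsub>T\<^esub> \<oplus>\<^bsub>T\<^esub> (a' \<otimes>\<^bsub>T\<^esub> b) \<otimes>\<^bsub>T\<^esub> t) \<in> Units T" using aU by blast
    moreover have "a \<otimes>\<^bsub>T\<^esub> (\<one>\<^bsub>T\<^esub> \<oplus>\<^bsub>T\<^esub> (a' \<otimes>\<^bsub>T\<^esub> b) \<otimes>\<^bsub>T\<^esub> t) = a \<oplus>\<^bsub>T\<^esub> (a \<otimes>\<^bsub>T\<^esub> a') \<otimes>\<^bsub>T\<^esub> b \<otimes>\<^bsub>T\<^esub> t"
      using c t by (simp add: T.r_distr T.m_assoc)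
    ultimately show ?thesis using a' c by simp
  qed
  have aug: "\<one>\<^bsub>T\<^esub> \<oplus>\<^bsub>T\<^esub> b \<otimes>\<^bsub>T\<^esub> (t \<ominus>\<^bsub>T\<^esub> \<one>\<^bsub>T\<^esub>) \<in> Units T" if b: "b \<in> A" for b
  proof (rule T.Units_one_plus)
    obtain b' where b': "b' \<in> A" "t \<otimes>\<^bsub>T\<^esub> b = b' \<otimes>\<^bsub>T\<^esub> t" "e b' = e b" using conj' b by blast
    note c = Ac [OF b] Ac [OF b'(1)]
    let ?p = "b \<otimes>\<^bsub>T\<^esub> (t \<ominus>\<^bsub>T\<^esub> \<one>\<^bsub>T\<^esub>)"
    show "?p \<in> carrier T" using c t by simp
    \<comment> \<open>Expanding with tb = b't gives p^2 = bb't^2 - bb't - b^2 t + b^2. Thus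
      \<open>?u\<close> and \<open>?v\<close> are the coefficients of 1 and \<open>t\<close> in 1 -
      p^2, and \<open>e\<close> sends them to 1 - 2y and 2y, where y is the square of
      \<open>e b\<close>.\<close>
    let ?u = "\<one>\<^bsub>T\<^esub> \<ominus>\<^bsub>T\<^esub> (b \<otimes>\<^bsub>T\<^esub> b \<oplus>\<^bsub>T\<^esub> b \<otimes>\<^bsub>T\<^esub> b' \<otimes>\<^bsub>T\<^esub> (t \<otimes>\<^bsub>T\<^esub> t))"
    let ?v = "b \<otimes>\<^bsub>T\<^esub> b \<oplus>\<^bsub>T\<^esub> b \<otimes>\<^bsub>T\<^esub> b'"
    let ?y = "e b \<otimes>\<^bsub>R\<^esub> e b"
    have "?p \<otimes>\<^bsub>T\<^esub> ?p = b \<otimes>\<^bsub>T\<^esub> (t \<otimes>\<^bsub>T\<^esub> b) \<otimes>\<^bsub>T\<^esub> t \<ominus>\<^bsub>T\<^esub> b \<otimes>\<^bsub>T\<^esub> (t \<otimes>\<^bsub>T\<^esub> b) \<ominus>\<^bsub>T\<^esub> b \<otimes>\<^bsub>T\<^esub> b \<otimes>\<^bsub>T\<^esub> t \<oplus>\<^bsub>T\<^esub> b \<otimes>\<^bsub>T\<^esub> b"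
      using c t by (simp add: T.ring_simprules)
    also have "\<dots> = b \<otimes>\<^bsub>T\<^esub> (b' \<otimes>\<^bsub>T\<^esub> t) \<otimes>\<^bsub>T\<^esub> t \<ominus>\<^bsub>T\<^esub> b \<otimes>\<^bsub>T\<^esub> (b' \<otimes>\<^bsub>T\<^esub> t) \<ominus>\<^bsub>T\<^esub> b \<otimes>\<^bsub>T\<^esub> b \<otimes>\<^bsub>T\<^esub> t \<oplus>\<^bsub>T\<^esub> b \<otimes>\<^bsub>T\<^esub> b"
      by (simp only: b'(2))
    finally have "\<one>\<^bsub>T\<^esub> \<ominus>\<^bsub>T\<^esub> ?p \<otimes>\<^bsub>T\<^esub> ?p = ?u \<oplus>\<^bsub>T\<^esub> ?v \<otimes>\<^bsub>T\<^esub> t"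
      using c t by (simp add: T.ring_simprules)
    moreover have "?u \<oplus>\<^bsub>T\<^esub> ?v \<otimes>\<^bsub>T\<^esub> t \<in> Units T"
    proof (rule even [of _ _ ?y])
      show "?u \<in> A" "?v \<in> A" using b b' t Asub Aminus by simp_all
      show "e ?v = ?y \<oplus>\<^bsub>R\<^esub> ?y" "?y \<in> carrier R" using c b' by simp_all
      have "e ?u = \<one>\<^bsub>R\<^esub> \<ominus>\<^bsub>R\<^esub> (?y \<oplus>\<^bsub>R\<^esub> ?y)" using c b' t by (simp add: eminus)
      then show "e ?u \<in> Units R" using c two by simp
    qed
    ultimately show "\<one>\<^bsub>T\<^esub> \<ominus>\<^bsub>T\<^esub> ?p \<otimes>\<^bsub>T\<^esub> ?p \<in> Units T" by simp
  qed
  obtain a b where ab: "a \<in> A" "b \<in> A" "f = a \<oplus>\<^bsub>T\<^esub> b \<otimes>\<^bsub>T\<^esub> t" using dec f by blast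
  let ?s = "a \<oplus>\<^bsub>T\<^esub> b"
  \<comment> \<open>The sum a + b is what \<open>f\<close> becomes when \<open>t\<close> is replaced
    by 1. It has the same image as \<open>f\<close> but lies in \<open>A\<close>, so it can be
    inverted there.\<close>
  have "e ?s = e f" using ab Ac t by simp
  then have "?s \<in> Units (T\<lparr>carrier := A\<rparr>)" using lift f ab Asub by simp
  then obtain s' where s': "s' \<in> A" "?s \<otimes>\<^bsub>T\<^esub> s' = \<one>\<^bsub>T\<^esub>" "s' \<otimes>\<^bsub>T\<^esub> ?s = \<one>\<^bsub>T\<^esub>" by (auto simp: Units_def)
  note c = Ac [OF ab(1)] Ac [OF ab(2)] Ac [OF s'(1)]
  have "?s \<in> Units T" using s' c unfolding Units_def by auto
  then have "?s \<otimes>\<^bsub>T\<^esub> (\<one>\<^bsub>T\<^esub> \<oplus>\<^bsub>T\<^esub> (s' \<otimes>\<^bsub>T\<^esub> b) \<otimes>\<^bsub>T\<^esub> (t \<ominus>\<^bsub>T\<^esub> \<one>\<^bsub>T\<^esub>)) \<in> Units T"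
    using aug [of "s' \<otimes>\<^bsub>T\<^esub> b"] s' ab Asub by blast
  moreover have "?s \<otimes>\<^bsub>T\<^esub> (\<one>\<^bsub>T\<^esub> \<oplus>\<^bsub>T\<^esub> (s' \<otimes>\<^bsub>T\<^esub> b) \<otimes>\<^bsub>T\<^esub> (t \<ominus>\<^bsub>T\<^esub> \<one>\<^bsub>T\<^esub>)) = ?s \<oplus>\<^bsub>T\<^esub> (?s \<otimes>\<^bsub>T\<^esub> s') \<otimes>\<^bsub>T\<^esub> (b \<otimes>\<^bsub>T\<^esub> (t \<ominus>\<^bsub>T\<^esub> \<one>\<^bsub>T\<^esub>))"
    using c t by (simp add: T.r_distr T.m_assoc)
  moreover have "\<dots> = f" unfolding s'(2) ab(3) using c t by (simp add: T.ring_simprules)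
  ultimately show ?thesis by simp
qed

subsection \<open>Finite 2-groups\<close>

text \<open>By counting, \<open>H\<close> is the disjoint union of \<open>K\<close> and the coset
  \<open>K t\<close> for any \<open>t\<close> in \<open>H\<close> outside \<open>K\<close>. The
  conclusions supply the decomposition and conjugation hypotheses of
  \<open>Units_lift_index_two\<close>.\<close>

lemma (in group) index_two_transversal:
  assumes H: "subgroup H G" "finite H" and K: "subgroup K G" "K \<subseteq> H" and card: "card H = 2 * card K"
  obtains t where "t \<in> H" "t \<notin> K" "t \<otimes> t \<in> K" "\<And>h. h \<in> H \<Longrightarrow> h \<in> K \<or> h \<otimes> inv t \<in> K"
    "\<And>k. k \<in> K \<Longrightarrow> t \<otimes> k \<otimes> inv t \<in> K"
proof -
  have fK: "finite K" using K H finite_subset by blast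
  have "card K > 0" using fK subgroup.one_closed [OF K(1)] card_gt_0_iff by blast
  then have "card K < card H" using card by simp
  then have "\<not> H \<subseteq> K" using card_mono [OF fK, of H] by linarith
  then obtain t where t: "t \<in> H" "t \<notin> K" by blast
  have Hc: "h \<in> carrier G" if "h \<in> H" for h using subgroup.mem_carrier [OF H(1) that] .
  have Kc: "k \<in> carrier G" if "k \<in> K" for k using that K Hc by blast
  note tc = Hc [OF t(1)]
  have "card (K #> t) = card K"
    using card_rcosets_equal [of "K #> t" K] tc K(1) subgroup.subset [OF K(1)] by (metis (no_types) rcosetsI)
  moreover have disj: "K \<inter> (K #> t) = {}"
  proof (rule ccontr)
    assume "\<not> ?thesis"
    then obtain k where k: "k \<in> K" "k \<otimes> t \<in> K" by (auto simp: r_coset_def)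
    then have "inv k \<otimes> (k \<otimes> t) \<in> K" using K(1) by (simp add: subgroup.m_closed subgroup.m_inv_closed)
    then show False using k t tc Kc by (simp add: m_assoc [symmetric])
  qed
  ultimately have "card (K \<union> (K #> t)) = card H"
    using fK tc card by (subst card_Un_disjoint) (auto simp: r_coset_def)
  moreover have sub: "K \<union> (K #> t) \<subseteq> H"
    using K t H(1) by (auto simp: r_coset_def subgroup.m_closed)
  ultimately have eq: "K \<union> (K #> t) = H" using H(2) by (simp add: card_subset_eq)
  have dich: "h \<in> K \<or> h \<otimes> inv t \<in> K" if "h \<in> H" for h
    using that Kc tc unfolding eq [symmetric] by (auto simp: r_coset_def m_assoc)
  show ?thesis
  \<comment> \<open>Each claim excludes one of the two cosets: if \<open>t t\<close> were in
    \<open>K t\<close>, or \<open>t k\<close> in \<open>K\<close>, then \<open>t\<close> itself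
    would lie in \<open>K\<close>.\<close>
  proof (rule that [OF t _ dich])
    have "t \<otimes> t \<in> H" using t H(1) by (simp add: subgroup.m_closed)
    then show "t \<otimes> t \<in> K" using dich [of "t \<otimes> t"] tc t by (auto simp: m_assoc)
    fix k assume k: "k \<in> K"
    have "t \<otimes> k \<in> H" using t k K H(1) by (auto simp: subgroup.m_closed)
    moreover have "t \<otimes> k \<notin> K"
    proof
      assume "t \<otimes> k \<in> K"
      then have "t \<otimes> k \<otimes> inv k \<in> K" using k K(1) by (simp add: subgroup.m_closed subgroup.m_inv_closed)
      then show False using k t tc Kc by (simp add: m_assoc)
    qed
    ultimately show "t \<otimes> k \<otimes> inv t \<in> K" using dich by blast
  qed
qed

text \<open>An odd prime p dividing the order of \<open>H\<close> would give a subgroup of order p.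
  A nontrivial element of it would have order dividing p and equal to a power of 2, hence order 1.
  So 2 is the only possible prime factor.\<close>

lemma (in group) two_group_card_subgroup:
  assumes "two_group G" and H: "subgroup H G" "finite H"
  obtains n :: nat where "card H = 2 ^ n"
proof -
  have pos: "card H > 0" using H(2) subgroup.one_closed [OF H(1)] by (metis card_gt_0_iff empty_iff)
  have two: "p = 2" if p: "prime p" "p dvd card H" for p
  proof (rule ccontr)
    assume "p \<noteq> 2"
    then have odd: "odd p" using p(1) primes_dvd_imp_eq two_is_prime_nat by blast
    obtain m where m: "card H = p * m" using p(2) by (rule dvdE)
    \<comment> \<open>With exponent 1, and m possibly still divisible by p, \<open>sylow_thm\<close>
      is Cauchy's theorem.\<close>
    have "order (G\<lparr>carrier := H\<rparr>) = p ^ 1 * m" by (simp add: order_def m)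
    then obtain P where P: "subgroup P (G\<lparr>carrier := H\<rparr>)" "card P = p ^ 1"
      using sylow_thm [OF p(1) subgroup_imp_group [OF H(1)], of 1 m] H(2) by auto
    have PG: "subgroup P G" using incl_subgroup [OF H(1) P(1)] .
    have "\<not> P \<subseteq> {\<one>}"
    proof
      assume "P \<subseteq> {\<one>}"
      then have "card P \<le> card {\<one>}" by (intro card_mono) simp_all
      then show False using P(2) prime_gt_1_nat [OF p(1)] by simp
    qed
    then obtain x where x: "x \<in> P" "x \<noteq> \<one>" by blast
    then have xc: "x \<in> carrier G" using subgroup.mem_carrier [OF PG] by simp
    interpret P: group "G\<lparr>carrier := P\<rparr>" using subgroup_imp_group [OF PG] .
    have "x [^]\<^bsub>G\<lparr>carrier := P\<rparr>\<^esub> order (G\<lparr>carrier := P\<rparr>) = \<one>\<^bsub>G\<lparr>carrier := P\<rparr>\<^esub>"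
      by (rule P.pow_order_eq_1) (simp add: x)
    then have "x [^] p = \<one>" using P(2) nat_pow_consistent [of x p P] by (simp add: order_def)
    then have "ord x dvd p" using xc by (simp add: pow_eq_id)
    moreover obtain k :: nat where k: "ord x = 2 ^ k" using assms(1) xc by (auto simp: two_group_def)
    ultimately have "k = 0" using odd by (metis dvd_power dvd_trans neq0_conv)
    then have "ord x = 1" using k by simp
    then show False using xc x(2) ord_eq_1 by blast
  qed
  then have "set_mset (prime_factorization (card H)) \<subseteq> {2}" by (auto simp: in_prime_factors_iff)
  then obtain n where "prime_factorization (card H) = replicate_mset n 2"
    using set_mset_subset_singletonD [of "prime_factorization (card H)" 2] by blast
  then have "card H = 2 ^ n" using prod_mset_prime_factorization_nat [OF pos] by simp
  then show thesis by (rule that)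
qed

subsection \<open>The group ring and its augmentation\<close>

lemma (in abelian_monoid) finsum_swap:
  assumes "finite A" "finite B" "\<And>i j. i \<in> A \<Longrightarrow> j \<in> B \<Longrightarrow> f i j \<in> carrier G"
  shows "(\<Oplus>i\<in>A. \<Oplus>j\<in>B. f i j) = (\<Oplus>j\<in>B. \<Oplus>i\<in>A. f i j)"
  using assms(1,3)
proof (induction A rule: finite_induct)
  case empty
  then show ?case by simp
next
  case (insert a A)
  have "(\<Oplus>j\<in>B. \<Oplus>i\<in>insert a A. f i j) = (\<Oplus>j\<in>B. f a j \<oplus> (\<Oplus>i\<in>A. f i j))"
    using insert by (intro finsum_cong') auto
  also have "\<dots> = (\<Oplus>j\<in>B. f a j) \<oplus> (\<Oplus>j\<in>B. \<Oplus>i\<in>A. f i j)"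
    using insert by (intro finsum_addf) auto
  also have "\<dots> = (\<Oplus>i\<in>insert a A. \<Oplus>j\<in>B. f i j)"
    using insert by (subst finsum_insert) (auto intro!: finsum_closed)
  finally show ?case by simp
qed

lemma finite_set_mult: "finite A \<Longrightarrow> finite B \<Longrightarrow> finite (A <#>\<^bsub>G\<^esub> B)"
  unfolding set_mult_def by simp

text \<open>The group element \<open>t\<close> seen inside \<open>R G\<close>. For \<open>t\<close>
  outside the carrier it is the zero element, so it always belongs to the group ring.\<close>

definition group_ring_delta :: "('a, 'm) ring_scheme \<Rightarrow> ('g, 'n) monoid_scheme \<Rightarrow> 'g \<Rightarrow> 'g \<Rightarrow> 'a" where
  "group_ring_delta R G t = (\<lambda>g\<in>carrier G. if g = t then \<one>\<^bsub>R\<^esub> else \<zero>\<^bsub>R\<^esub>)"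

text \<open>The sum is restricted to the support because \<open>finsum\<close> over an infinite
  carrier would be zero by convention.\<close>

definition augmentation :: "('a, 'm) ring_scheme \<Rightarrow> ('g, 'n) monoid_scheme \<Rightarrow> ('g \<Rightarrow> 'a) \<Rightarrow> 'a" where
  "augmentation R G f = (\<Oplus>\<^bsub>R\<^esub>x\<in>group_ring_supp R G f. f x)"

text \<open>For a subgroup \<open>K\<close> this is a copy of \<open>R K\<close> made of functions
  on all of \<open>G\<close>, so that the group rings of all subgroups are subrings of one ambient
  ring.\<close>

definition supported_on :: "('a, 'm) ring_scheme \<Rightarrow> ('g, 'n) monoid_scheme \<Rightarrow> 'g set \<Rightarrow> ('g \<Rightarrow> 'a) set" where
  "supported_on R G K = {f \<in> carrier (group_ring R G). group_ring_supp R G f \<subseteq> K}"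

locale ring_and_group = ring R + G: group G
  for R :: "('a, 'm) ring_scheme" (structure) and G :: "('g, 'n) monoid_scheme"
begin

abbreviation "S \<equiv> group_ring R G"
abbreviation "supp \<equiv> group_ring_supp R G"
abbreviation "\<delta> \<equiv> group_ring_delta R G"
abbreviation "\<epsilon> \<equiv> augmentation R G"

section \<open>Coefficients, supports and closure\<close>

lemma group_ring_carrier_iff:
  "f \<in> carrier S \<longleftrightarrow> f \<in> carrier G \<rightarrow>\<^sub>E carrier R \<and> finite (supp f)"
  unfolding group_ring_def by simp

lemma coeff_closed [simp, intro]: "f \<in> carrier S \<Longrightarrow> g \<in> carrier G \<Longrightarrow> f g \<in> carrier R"
  by (auto simp: group_ring_carrier_iff)

lemma finite_supp [simp, intro]: "f \<in> carrier S \<Longrightarrow> finite (supp f)"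
  by (simp add: group_ring_carrier_iff)

lemma supp_subset: "supp f \<subseteq> carrier G"
  by (auto simp: group_ring_supp_def)

lemma coeff_eq_zero: "g \<in> carrier G \<Longrightarrow> g \<notin> supp f \<Longrightarrow> f g = \<zero>"
  by (simp add: group_ring_supp_def)

lemma group_ring_eqI:
  assumes "f \<in> carrier S" "h \<in> carrier S" "\<And>g. g \<in> carrier G \<Longrightarrow> f g = h g"
  shows "f = h"
proof (rule PiE_ext)
  show "f \<in> carrier G \<rightarrow>\<^sub>E carrier R" "h \<in> carrier G \<rightarrow>\<^sub>E carrier R"
    using assms by (simp_all add: group_ring_carrier_iff)
qed (rule assms)

lemma group_ring_carrierI:
  assumes "f \<in> carrier G \<rightarrow>\<^sub>E carrier R" "finite D"
    and "\<And>g. g \<in> carrier G \<Longrightarrow> f g \<noteq> \<zero> \<Longrightarrow> g \<in> D"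
  shows "f \<in> carrier S"
proof -
  have "supp f \<subseteq> D" using assms(3) by (auto simp: group_ring_supp_def)
  then have "finite (supp f)" using assms(2) by (rule finite_subset)
  with assms(1) show ?thesis by (simp add: group_ring_carrier_iff)
qed

lemma coeff_zero [simp]: "g \<in> carrier G \<Longrightarrow> \<zero>\<^bsub>S\<^esub> g = \<zero>"
  unfolding group_ring_def by simp

lemma coeff_add [simp]: "g \<in> carrier G \<Longrightarrow> (f \<oplus>\<^bsub>S\<^esub> h) g = f g \<oplus> h g"
  unfolding group_ring_def by simp

text \<open>Indices outside the support contribute zero, so the convolution may be summed over any
  finite superset \<open>D\<close>. Different products can then share one index set.\<close>

lemma coeff_mult:
  assumes "f \<in> carrier S" "h \<in> carrier S" "g \<in> carrier G"
    and "finite D" "supp f \<subseteq> D" "D \<subseteq> carrier G"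
  shows "(f \<otimes>\<^bsub>S\<^esub> h) g = (\<Oplus>x\<in>D. f x \<otimes> h (inv\<^bsub>G\<^esub> x \<otimes>\<^bsub>G\<^esub> g))"
proof -
  have "(f \<otimes>\<^bsub>S\<^esub> h) g = (\<Oplus>x\<in>supp f. f x \<otimes> h (inv\<^bsub>G\<^esub> x \<otimes>\<^bsub>G\<^esub> g))"
    using assms unfolding group_ring_def by simp
  also have "\<dots> = (\<Oplus>x\<in>D. f x \<otimes> h (inv\<^bsub>G\<^esub> x \<otimes>\<^bsub>G\<^esub> g))"
    using assms by (intro add.finprod_mono_neutral_cong_left) (auto simp: coeff_eq_zero subset_eq)
  finally show ?thesis .
qed

text \<open>A nonzero coefficient at \<open>g\<close> needs a nonzero summand, that is, some x in
  the support of \<open>f\<close> with x^-1 g in the support of \<open>h\<close>; and g is the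
  product of these two.\<close>

lemma supp_mult:
  assumes "f \<in> carrier S" "h \<in> carrier S"
  shows "supp (f \<otimes>\<^bsub>S\<^esub> h) \<subseteq> supp f <#>\<^bsub>G\<^esub> supp h"
proof
  fix g assume g: "g \<in> supp (f \<otimes>\<^bsub>S\<^esub> h)"
  then have gc: "g \<in> carrier G" using supp_subset by auto
  have "\<exists>x\<in>supp f. inv\<^bsub>G\<^esub> x \<otimes>\<^bsub>G\<^esub> g \<in> supp h"
  proof (rule ccontr)
    assume "\<not> ?thesis"
    then have "f x \<otimes> h (inv\<^bsub>G\<^esub> x \<otimes>\<^bsub>G\<^esub> g) = \<zero>" if "x \<in> supp f" for x
      using that gc supp_subset [of f] assms coeff_eq_zero [of "inv\<^bsub>G\<^esub> x \<otimes>\<^bsub>G\<^esub> g" h] by auto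
    then have "(f \<otimes>\<^bsub>S\<^esub> h) g = \<zero>"
      using assms gc by (subst coeff_mult [where D = "supp f"]) (auto simp: supp_subset intro: add.finprod_one_eqI)
    with g show False by (simp add: group_ring_supp_def)
  qed
  then obtain x where x: "x \<in> supp f" "inv\<^bsub>G\<^esub> x \<otimes>\<^bsub>G\<^esub> g \<in> supp h" by blast
  then have "g = x \<otimes>\<^bsub>G\<^esub> (inv\<^bsub>G\<^esub> x \<otimes>\<^bsub>G\<^esub> g)"
    using gc supp_subset [of f] by (simp add: G.inv_solve_left' subset_eq G.m_assoc [symmetric])
  with x show "g \<in> supp f <#>\<^bsub>G\<^esub> supp h" unfolding set_mult_def by blast
qed

lemma group_ring_mult_closed [simp, intro]:
  assumes "f \<in> carrier S" "h \<in> carrier S"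
  shows "f \<otimes>\<^bsub>S\<^esub> h \<in> carrier S"
proof (rule group_ring_carrierI)
  have "(f \<otimes>\<^bsub>S\<^esub> h) g \<in> carrier R" if "g \<in> carrier G" for g
    using assms that supp_subset [of f]
    by (subst coeff_mult [where D = "supp f"]) (auto intro!: finsum_closed)
  moreover have "(f \<otimes>\<^bsub>S\<^esub> h) \<in> extensional (carrier G)" unfolding group_ring_def by simp
  ultimately show "f \<otimes>\<^bsub>S\<^esub> h \<in> carrier G \<rightarrow>\<^sub>E carrier R" by (auto simp: PiE_def)
  show "finite (supp f <#>\<^bsub>G\<^esub> supp h)" using assms by (simp add: finite_set_mult)
  show "g \<in> supp f <#>\<^bsub>G\<^esub> supp h" if "g \<in> carrier G" "(f \<otimes>\<^bsub>S\<^esub> h) g \<noteq> \<zero>" for g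
    using supp_mult [OF assms] that by (auto simp: group_ring_supp_def)
qed

lemma group_ring_add_closed [simp, intro]:
  assumes "f \<in> carrier S" "h \<in> carrier S"
  shows "f \<oplus>\<^bsub>S\<^esub> h \<in> carrier S"
proof (rule group_ring_carrierI)
  have "(f \<oplus>\<^bsub>S\<^esub> h) \<in> extensional (carrier G)" unfolding group_ring_def by simp
  then show "f \<oplus>\<^bsub>S\<^esub> h \<in> carrier G \<rightarrow>\<^sub>E carrier R" using assms by (auto simp: PiE_def)
  show "finite (supp f \<union> supp h)" using assms by simp
  show "g \<in> supp f \<union> supp h" if "g \<in> carrier G" "(f \<oplus>\<^bsub>S\<^esub> h) g \<noteq> \<zero>" for g
    using that by (metis UnI1 UnI2 coeff_add coeff_eq_zero r_zero zero_closed)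
qed

lemma group_ring_zero_closed [simp, intro]: "\<zero>\<^bsub>S\<^esub> \<in> carrier S"
  unfolding group_ring_def group_ring_supp_def by auto

lemma delta_closed [simp, intro]: "\<delta> t \<in> carrier S"
  by (rule group_ring_carrierI [of _ "{t}"]) (auto simp: group_ring_delta_def split: if_splits)

lemma coeff_delta [simp]: "g \<in> carrier G \<Longrightarrow> \<delta> t g = (if g = t then \<one> else \<zero>)"
  by (simp add: group_ring_delta_def)

lemma supp_delta: "supp (\<delta> t) \<subseteq> {t}"
  by (auto simp: group_ring_supp_def split: if_splits)

lemma one_eq_delta: "\<one>\<^bsub>S\<^esub> = \<delta> \<one>\<^bsub>G\<^esub>"
  unfolding group_ring_def group_ring_delta_def by simp

lemma coeff_delta_mult:
  assumes "t \<in> carrier G" "h \<in> carrier S" "g \<in> carrier G"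
  shows "(\<delta> t \<otimes>\<^bsub>S\<^esub> h) g = h (inv\<^bsub>G\<^esub> t \<otimes>\<^bsub>G\<^esub> g)"
  using assms supp_delta [of t] by (subst coeff_mult [where D = "{t}"]) auto

lemma coeff_mult_delta:
  assumes "t \<in> carrier G" "f \<in> carrier S" "g \<in> carrier G"
  shows "(f \<otimes>\<^bsub>S\<^esub> \<delta> t) g = f (g \<otimes>\<^bsub>G\<^esub> inv\<^bsub>G\<^esub> t)"
proof -
  let ?y = "g \<otimes>\<^bsub>G\<^esub> inv\<^bsub>G\<^esub> t"
  have iff: "inv\<^bsub>G\<^esub> x \<otimes>\<^bsub>G\<^esub> g = t \<longleftrightarrow> x = ?y" if "x \<in> carrier G" for x
    using that assms by (metis G.inv_solve_left G.inv_solve_right)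
  \<comment> \<open>Only the index \<open>?y\<close> can contribute. It may lie outside the support
    of \<open>f\<close>, so it is inserted to make \<open>finsum_singleton\<close>
    applicable.\<close>
  have "(f \<otimes>\<^bsub>S\<^esub> \<delta> t) g = (\<Oplus>x\<in>insert ?y (supp f). f x \<otimes> \<delta> t (inv\<^bsub>G\<^esub> x \<otimes>\<^bsub>G\<^esub> g))"
    using assms supp_subset [of f] by (intro coeff_mult) auto
  also have "\<dots> = (\<Oplus>x\<in>insert ?y (supp f). if ?y = x then f x else \<zero>)"
    using assms supp_subset [of f] by (intro finsum_cong') (auto simp: iff subset_eq)
  also have "\<dots> = f ?y"
    using assms supp_subset [of f] by (intro finsum_singleton) auto
  finally show ?thesis .
qed

section \<open>Ring axioms for the convolution product\<close>

lemma group_ring_mult_assoc: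
  assumes "f \<in> carrier S" "h \<in> carrier S" "k \<in> carrier S"
  shows "(f \<otimes>\<^bsub>S\<^esub> h) \<otimes>\<^bsub>S\<^esub> k = f \<otimes>\<^bsub>S\<^esub> (h \<otimes>\<^bsub>S\<^esub> k)"
proof (rule group_ring_eqI)
  fix g assume g: "g \<in> carrier G"
  let ?F = "supp f"
  \<comment> \<open>Both sides become double sums over \<open>?F\<close> and \<open>?Y\<close>,
    which are then interchanged. For x in \<open>?F\<close>, the set \<open>?Y\<close> contains the
    x-translate of the support of \<open>h\<close>, so substituting z = x^-1 y turns the sum over
    \<open>?Y\<close> into a coefficient of \<open>h k\<close>.\<close>
  let ?Y = "supp f <#>\<^bsub>G\<^esub> supp h"
  have F: "?F \<subseteq> carrier G" and Y: "?Y \<subseteq> carrier G"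
    using supp_subset by (auto simp: set_mult_def subset_eq)
  have fin: "finite ?F" "finite ?Y" using assms by (auto intro: finite_set_mult)
  note Fc = F [THEN subsetD] and Yc = Y [THEN subsetD]
  have inner: "(\<Oplus>y\<in>?Y. h (inv\<^bsub>G\<^esub> x \<otimes>\<^bsub>G\<^esub> y) \<otimes> k (inv\<^bsub>G\<^esub> y \<otimes>\<^bsub>G\<^esub> g)) = (h \<otimes>\<^bsub>S\<^esub> k) (inv\<^bsub>G\<^esub> x \<otimes>\<^bsub>G\<^esub> g)"
    if x: "x \<in> ?F" for x
  proof -
    let ?Z = "(\<lambda>y. inv\<^bsub>G\<^esub> x \<otimes>\<^bsub>G\<^esub> y) ` ?Y"
    have xc: "x \<in> carrier G" using Fc x .
    have "z \<in> ?Z" if "z \<in> supp h" for z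
    proof
      show "x \<otimes>\<^bsub>G\<^esub> z \<in> ?Y" using x that by (auto simp: set_mult_def)
      show "z = inv\<^bsub>G\<^esub> x \<otimes>\<^bsub>G\<^esub> (x \<otimes>\<^bsub>G\<^esub> z)" using xc that supp_subset [of h]
        by (simp add: G.m_assoc [symmetric] subset_eq)
    qed
    then have "(h \<otimes>\<^bsub>S\<^esub> k) (inv\<^bsub>G\<^esub> x \<otimes>\<^bsub>G\<^esub> g) = (\<Oplus>z\<in>?Z. h z \<otimes> k (inv\<^bsub>G\<^esub> z \<otimes>\<^bsub>G\<^esub> (inv\<^bsub>G\<^esub> x \<otimes>\<^bsub>G\<^esub> g)))"
      using assms xc g fin Yc by (intro coeff_mult) auto
    also have "\<dots> = (\<Oplus>y\<in>?Y. h (inv\<^bsub>G\<^esub> x \<otimes>\<^bsub>G\<^esub> y) \<otimes> k (inv\<^bsub>G\<^esub> (inv\<^bsub>G\<^esub> x \<otimes>\<^bsub>G\<^esub> y) \<otimes>\<^bsub>G\<^esub> (inv\<^bsub>G\<^esub> x \<otimes>\<^bsub>G\<^esub> g)))"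
      using assms xc g Yc by (intro finsum_reindex) (auto simp: inj_on_def)
    also have "\<dots> = (\<Oplus>y\<in>?Y. h (inv\<^bsub>G\<^esub> x \<otimes>\<^bsub>G\<^esub> y) \<otimes> k (inv\<^bsub>G\<^esub> y \<otimes>\<^bsub>G\<^esub> g))"
    proof (intro finsum_cong')
      fix y assume "y \<in> ?Y"
      then have yc: "y \<in> carrier G" by (rule Yc)
      have "inv\<^bsub>G\<^esub> (inv\<^bsub>G\<^esub> x \<otimes>\<^bsub>G\<^esub> y) \<otimes>\<^bsub>G\<^esub> (inv\<^bsub>G\<^esub> x \<otimes>\<^bsub>G\<^esub> g) = inv\<^bsub>G\<^esub> y \<otimes>\<^bsub>G\<^esub> g"
        using xc yc g by (simp add: G.inv_mult_group G.m_assoc G.inv_solve_left')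
          (metis G.inv_closed G.l_one G.m_assoc G.r_inv)
      then show "h (inv\<^bsub>G\<^esub> x \<otimes>\<^bsub>G\<^esub> y) \<otimes> k (inv\<^bsub>G\<^esub> (inv\<^bsub>G\<^esub> x \<otimes>\<^bsub>G\<^esub> y) \<otimes>\<^bsub>G\<^esub> (inv\<^bsub>G\<^esub> x \<otimes>\<^bsub>G\<^esub> g))
        = h (inv\<^bsub>G\<^esub> x \<otimes>\<^bsub>G\<^esub> y) \<otimes> k (inv\<^bsub>G\<^esub> y \<otimes>\<^bsub>G\<^esub> g)" by simp
    qed (use assms xc g Yc in auto)
    finally show ?thesis by simp
  qed
  have "((f \<otimes>\<^bsub>S\<^esub> h) \<otimes>\<^bsub>S\<^esub> k) g = (\<Oplus>y\<in>?Y. (f \<otimes>\<^bsub>S\<^esub> h) y \<otimes> k (inv\<^bsub>G\<^esub> y \<otimes>\<^bsub>G\<^esub> g))"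
    using assms g fin Y supp_mult by (intro coeff_mult) auto
  also have "\<dots> = (\<Oplus>y\<in>?Y. \<Oplus>x\<in>?F. f x \<otimes> (h (inv\<^bsub>G\<^esub> x \<otimes>\<^bsub>G\<^esub> y) \<otimes> k (inv\<^bsub>G\<^esub> y \<otimes>\<^bsub>G\<^esub> g)))"
  proof (intro finsum_cong')
    fix y assume "y \<in> ?Y"
    then have yc: "y \<in> carrier G" by (rule Yc)
    have "(f \<otimes>\<^bsub>S\<^esub> h) y \<otimes> k (inv\<^bsub>G\<^esub> y \<otimes>\<^bsub>G\<^esub> g) = (\<Oplus>x\<in>?F. f x \<otimes> h (inv\<^bsub>G\<^esub> x \<otimes>\<^bsub>G\<^esub> y)) \<otimes> k (inv\<^bsub>G\<^esub> y \<otimes>\<^bsub>G\<^esub> g)"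
      using assms F fin yc by (subst coeff_mult [where D = ?F]) auto
    also have "\<dots> = (\<Oplus>x\<in>?F. f x \<otimes> h (inv\<^bsub>G\<^esub> x \<otimes>\<^bsub>G\<^esub> y) \<otimes> k (inv\<^bsub>G\<^esub> y \<otimes>\<^bsub>G\<^esub> g))"
      using assms fin yc g Fc by (intro finsum_ldistr) auto
    also have "\<dots> = (\<Oplus>x\<in>?F. f x \<otimes> (h (inv\<^bsub>G\<^esub> x \<otimes>\<^bsub>G\<^esub> y) \<otimes> k (inv\<^bsub>G\<^esub> y \<otimes>\<^bsub>G\<^esub> g)))"
      using assms yc g Fc by (intro finsum_cong') (auto simp: m_assoc)
    finally show "(f \<otimes>\<^bsub>S\<^esub> h) y \<otimes> k (inv\<^bsub>G\<^esub> y \<otimes>\<^bsub>G\<^esub> g) = (\<Oplus>x\<in>?F. f x \<otimes> (h (inv\<^bsub>G\<^esub> x \<otimes>\<^bsub>G\<^esub> y) \<otimes> k (inv\<^bsub>G\<^esub> y \<otimes>\<^bsub>G\<^esub> g)))" .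
  qed (use assms g Yc Fc in \<open>auto intro!: finsum_closed\<close>)
  also have "\<dots> = (\<Oplus>x\<in>?F. \<Oplus>y\<in>?Y. f x \<otimes> (h (inv\<^bsub>G\<^esub> x \<otimes>\<^bsub>G\<^esub> y) \<otimes> k (inv\<^bsub>G\<^esub> y \<otimes>\<^bsub>G\<^esub> g)))"
    using assms fin g Fc Yc by (intro finsum_swap) auto
  also have "\<dots> = (\<Oplus>x\<in>?F. f x \<otimes> (h \<otimes>\<^bsub>S\<^esub> k) (inv\<^bsub>G\<^esub> x \<otimes>\<^bsub>G\<^esub> g))"
  proof (intro finsum_cong')
    fix x assume x: "x \<in> ?F"
    have "(\<Oplus>y\<in>?Y. f x \<otimes> (h (inv\<^bsub>G\<^esub> x \<otimes>\<^bsub>G\<^esub> y) \<otimes> k (inv\<^bsub>G\<^esub> y \<otimes>\<^bsub>G\<^esub> g)))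
        = f x \<otimes> (\<Oplus>y\<in>?Y. h (inv\<^bsub>G\<^esub> x \<otimes>\<^bsub>G\<^esub> y) \<otimes> k (inv\<^bsub>G\<^esub> y \<otimes>\<^bsub>G\<^esub> g))"
      using assms fin g Fc [OF x] Yc by (intro finsum_rdistr [symmetric]) auto
    then show "(\<Oplus>y\<in>?Y. f x \<otimes> (h (inv\<^bsub>G\<^esub> x \<otimes>\<^bsub>G\<^esub> y) \<otimes> k (inv\<^bsub>G\<^esub> y \<otimes>\<^bsub>G\<^esub> g)))
        = f x \<otimes> (h \<otimes>\<^bsub>S\<^esub> k) (inv\<^bsub>G\<^esub> x \<otimes>\<^bsub>G\<^esub> g)" by (simp add: inner x)
  qed (use assms g Fc in auto)
  also have "\<dots> = (f \<otimes>\<^bsub>S\<^esub> (h \<otimes>\<^bsub>S\<^esub> k)) g"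
    using assms g fin F by (intro coeff_mult [symmetric]) auto
  finally show "((f \<otimes>\<^bsub>S\<^esub> h) \<otimes>\<^bsub>S\<^esub> k) g = (f \<otimes>\<^bsub>S\<^esub> (h \<otimes>\<^bsub>S\<^esub> k)) g" .
qed (use assms in auto)

lemma ring_group_ring: "ring S"
proof (rule ringI)
  show "abelian_group S"
  proof (rule abelian_groupI)
    fix f assume f: "f \<in> carrier S"
    let ?n = "\<lambda>g\<in>carrier G. \<ominus> f g"
    have n: "?n \<in> carrier S"
      using f coeff_eq_zero [of _ f] by (intro group_ring_carrierI [of _ "supp f"]) force+
    have "?n \<oplus>\<^bsub>S\<^esub> f = \<zero>\<^bsub>S\<^esub>" using f n by (intro group_ring_eqI) (auto simp: l_neg)
    with n show "\<exists>h\<in>carrier S. h \<oplus>\<^bsub>S\<^esub> f = \<zero>\<^bsub>S\<^esub>" by blast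
  qed (auto intro!: group_ring_eqI simp: a_ac)
  show "monoid S"
  proof (rule monoidI)
    show "\<one>\<^bsub>S\<^esub> \<in> carrier S" by (simp add: one_eq_delta)
    show "\<one>\<^bsub>S\<^esub> \<otimes>\<^bsub>S\<^esub> f = f" "f \<otimes>\<^bsub>S\<^esub> \<one>\<^bsub>S\<^esub> = f" if "f \<in> carrier S" for f
      using that by (auto intro!: group_ring_eqI simp: one_eq_delta coeff_delta_mult coeff_mult_delta)
  qed (auto simp: group_ring_mult_assoc)
next
  fix f h k assume c: "f \<in> carrier S" "h \<in> carrier S" "k \<in> carrier S"
  show "(f \<oplus>\<^bsub>S\<^esub> h) \<otimes>\<^bsub>S\<^esub> k = f \<otimes>\<^bsub>S\<^esub> k \<oplus>\<^bsub>S\<^esub> h \<otimes>\<^bsub>S\<^esub> k"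
  proof (rule group_ring_eqI)
    fix g assume g: "g \<in> carrier G"
    let ?D = "supp f \<union> supp h"
    have D: "finite ?D" "?D \<subseteq> carrier G" using c supp_subset by auto
    have fh: "supp (f \<oplus>\<^bsub>S\<^esub> h) \<subseteq> ?D" by (auto simp: group_ring_supp_def)
    have "((f \<oplus>\<^bsub>S\<^esub> h) \<otimes>\<^bsub>S\<^esub> k) g = (\<Oplus>x\<in>?D. (f \<oplus>\<^bsub>S\<^esub> h) x \<otimes> k (inv\<^bsub>G\<^esub> x \<otimes>\<^bsub>G\<^esub> g))"
      using c g D fh by (intro coeff_mult) auto
    also have "\<dots> = (\<Oplus>x\<in>?D. f x \<otimes> k (inv\<^bsub>G\<^esub> x \<otimes>\<^bsub>G\<^esub> g) \<oplus> h x \<otimes> k (inv\<^bsub>G\<^esub> x \<otimes>\<^bsub>G\<^esub> g))"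
      using c g D(2)[THEN subsetD] by (intro finsum_cong') (auto simp: l_distr)
    also have "\<dots> = (\<Oplus>x\<in>?D. f x \<otimes> k (inv\<^bsub>G\<^esub> x \<otimes>\<^bsub>G\<^esub> g)) \<oplus> (\<Oplus>x\<in>?D. h x \<otimes> k (inv\<^bsub>G\<^esub> x \<otimes>\<^bsub>G\<^esub> g))"
      using c g D(2)[THEN subsetD] by (intro finsum_addf) auto
    also have "\<dots> = (f \<otimes>\<^bsub>S\<^esub> k \<oplus>\<^bsub>S\<^esub> h \<otimes>\<^bsub>S\<^esub> k) g"
      using c g D coeff_mult [of f k g ?D] coeff_mult [of h k g ?D] by simp
    finally show "((f \<oplus>\<^bsub>S\<^esub> h) \<otimes>\<^bsub>S\<^esub> k) g = (f \<otimes>\<^bsub>S\<^esub> k \<oplus>\<^bsub>S\<^esub> h \<otimes>\<^bsub>S\<^esub> k) g" .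
  qed (use c in auto)
  show "k \<otimes>\<^bsub>S\<^esub> (f \<oplus>\<^bsub>S\<^esub> h) = k \<otimes>\<^bsub>S\<^esub> f \<oplus>\<^bsub>S\<^esub> k \<otimes>\<^bsub>S\<^esub> h"
  proof (rule group_ring_eqI)
    fix g assume g: "g \<in> carrier G"
    let ?D = "supp k"
    have D: "finite ?D" "?D \<subseteq> carrier G" using c supp_subset by auto
    have "(k \<otimes>\<^bsub>S\<^esub> (f \<oplus>\<^bsub>S\<^esub> h)) g = (\<Oplus>x\<in>?D. k x \<otimes> (f \<oplus>\<^bsub>S\<^esub> h) (inv\<^bsub>G\<^esub> x \<otimes>\<^bsub>G\<^esub> g))"
      using c g D by (intro coeff_mult) auto
    also have "\<dots> = (\<Oplus>x\<in>?D. k x \<otimes> f (inv\<^bsub>G\<^esub> x \<otimes>\<^bsub>G\<^esub> g) \<oplus> k x \<otimes> h (inv\<^bsub>G\<^esub> x \<otimes>\<^bsub>G\<^esub> g))"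
      using c g D(2)[THEN subsetD] by (intro finsum_cong') (auto simp: r_distr)
    also have "\<dots> = (\<Oplus>x\<in>?D. k x \<otimes> f (inv\<^bsub>G\<^esub> x \<otimes>\<^bsub>G\<^esub> g)) \<oplus> (\<Oplus>x\<in>?D. k x \<otimes> h (inv\<^bsub>G\<^esub> x \<otimes>\<^bsub>G\<^esub> g))"
      using c g D(2)[THEN subsetD] by (intro finsum_addf) auto
    also have "\<dots> = (k \<otimes>\<^bsub>S\<^esub> f \<oplus>\<^bsub>S\<^esub> k \<otimes>\<^bsub>S\<^esub> h) g"
      using c g D coeff_mult [of k f g ?D] coeff_mult [of k h g ?D] by simp
    finally show "(k \<otimes>\<^bsub>S\<^esub> (f \<oplus>\<^bsub>S\<^esub> h)) g = (k \<otimes>\<^bsub>S\<^esub> f \<oplus>\<^bsub>S\<^esub> k \<otimes>\<^bsub>S\<^esub> h) g" .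
  qed (use c in auto)
qed

section \<open>The augmentation homomorphism\<close>

lemma augmentation_eq:
  assumes "f \<in> carrier S" "finite D" "supp f \<subseteq> D" "D \<subseteq> carrier G"
  shows "\<epsilon> f = (\<Oplus>x\<in>D. f x)"
  unfolding augmentation_def using assms
  by (intro add.finprod_mono_neutral_cong_left) (auto simp: coeff_eq_zero subset_eq)

lemma augmentation_delta [simp]: "t \<in> carrier G \<Longrightarrow> \<epsilon> (\<delta> t) = \<one>"
  using supp_delta [of t] by (subst augmentation_eq [of _ "{t}"]) auto

lemma augmentation_closed [simp, intro]: "f \<in> carrier S \<Longrightarrow> \<epsilon> f \<in> carrier R"
  unfolding augmentation_def using supp_subset [of f] by (intro finsum_closed) auto

text \<open>The coefficients of the product are summed over y first. For fixed x, translation by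
  x^-1 carries \<open>?Y\<close> onto a finite set containing the support of \<open>h\<close>, so
  the inner sum is \<open>\<epsilon> h\<close> for every x and factors out.\<close>

lemma augmentation_mult:
  assumes "f \<in> carrier S" "h \<in> carrier S"
  shows "\<epsilon> (f \<otimes>\<^bsub>S\<^esub> h) = \<epsilon> f \<otimes> \<epsilon> h"
proof -
  let ?F = "supp f"
  let ?Y = "supp f <#>\<^bsub>G\<^esub> supp h"
  have F: "?F \<subseteq> carrier G" and Y: "?Y \<subseteq> carrier G"
    using supp_subset by (auto simp: set_mult_def subset_eq)
  have fin: "finite ?F" "finite ?Y" using assms by (auto intro: finite_set_mult)
  note Fc = F [THEN subsetD] and Yc = Y [THEN subsetD]
  have inner: "(\<Oplus>y\<in>?Y. h (inv\<^bsub>G\<^esub> x \<otimes>\<^bsub>G\<^esub> y)) = \<epsilon> h" if x: "x \<in> ?F" for x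
  proof -
    let ?Z = "(\<lambda>y. inv\<^bsub>G\<^esub> x \<otimes>\<^bsub>G\<^esub> y) ` ?Y"
    have xc: "x \<in> carrier G" using Fc x .
    have "z \<in> ?Z" if "z \<in> supp h" for z
    proof
      show "x \<otimes>\<^bsub>G\<^esub> z \<in> ?Y" using x that by (auto simp: set_mult_def)
      show "z = inv\<^bsub>G\<^esub> x \<otimes>\<^bsub>G\<^esub> (x \<otimes>\<^bsub>G\<^esub> z)" using xc that supp_subset [of h]
        by (simp add: G.m_assoc [symmetric] subset_eq)
    qed
    then have "\<epsilon> h = (\<Oplus>z\<in>?Z. h z)"
      using assms xc fin Yc by (intro augmentation_eq) auto
    also have "\<dots> = (\<Oplus>y\<in>?Y. h (inv\<^bsub>G\<^esub> x \<otimes>\<^bsub>G\<^esub> y))"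
      using assms xc Yc by (intro finsum_reindex) (auto simp: inj_on_def)
    finally show ?thesis by simp
  qed
  have "\<epsilon> (f \<otimes>\<^bsub>S\<^esub> h) = (\<Oplus>y\<in>?Y. (f \<otimes>\<^bsub>S\<^esub> h) y)"
    using assms fin Y supp_mult by (intro augmentation_eq) auto
  also have "\<dots> = (\<Oplus>y\<in>?Y. \<Oplus>x\<in>?F. f x \<otimes> h (inv\<^bsub>G\<^esub> x \<otimes>\<^bsub>G\<^esub> y))"
    using assms fin F Fc Yc by (intro finsum_cong') (auto intro!: finsum_closed coeff_mult)
  also have "\<dots> = (\<Oplus>x\<in>?F. \<Oplus>y\<in>?Y. f x \<otimes> h (inv\<^bsub>G\<^esub> x \<otimes>\<^bsub>G\<^esub> y))"
    using assms fin Fc Yc by (intro finsum_swap) auto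
  also have "\<dots> = (\<Oplus>x\<in>?F. f x \<otimes> \<epsilon> h)"
  proof (intro finsum_cong')
    fix x assume x: "x \<in> ?F"
    have "(\<Oplus>y\<in>?Y. f x \<otimes> h (inv\<^bsub>G\<^esub> x \<otimes>\<^bsub>G\<^esub> y)) = f x \<otimes> (\<Oplus>y\<in>?Y. h (inv\<^bsub>G\<^esub> x \<otimes>\<^bsub>G\<^esub> y))"
      using assms fin Fc [OF x] Yc by (intro finsum_rdistr [symmetric]) auto
    then show "(\<Oplus>y\<in>?Y. f x \<otimes> h (inv\<^bsub>G\<^esub> x \<otimes>\<^bsub>G\<^esub> y)) = f x \<otimes> \<epsilon> h" by (simp add: inner x)
  qed (use assms Fc in auto)
  also have "\<dots> = \<epsilon> f \<otimes> \<epsilon> h"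
    unfolding augmentation_def [of _ _ f] using assms fin Fc by (intro finsum_ldistr [symmetric]) auto
  finally show ?thesis .
qed

lemma augmentation_hom: "\<epsilon> \<in> ring_hom S R"
proof (rule ring_hom_memI)
  fix f h assume c: "f \<in> carrier S" "h \<in> carrier S"
  let ?D = "supp f \<union> supp h"
  have D: "finite ?D" "?D \<subseteq> carrier G" using c supp_subset by auto
  have "\<epsilon> (f \<oplus>\<^bsub>S\<^esub> h) = (\<Oplus>x\<in>?D. (f \<oplus>\<^bsub>S\<^esub> h) x)"
    using c D by (intro augmentation_eq) (auto simp: group_ring_supp_def)
  also have "\<dots> = (\<Oplus>x\<in>?D. f x \<oplus> h x)"
    using c D(2)[THEN subsetD] by (intro finsum_cong') auto
  also have "\<dots> = (\<Oplus>x\<in>?D. f x) \<oplus> (\<Oplus>x\<in>?D. h x)"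
    using c D(2)[THEN subsetD] by (intro finsum_addf) auto
  also have "\<dots> = \<epsilon> f \<oplus> \<epsilon> h"
    using c D augmentation_eq [of f ?D] augmentation_eq [of h ?D] by simp
  finally show "\<epsilon> (f \<oplus>\<^bsub>S\<^esub> h) = \<epsilon> f \<oplus> \<epsilon> h" .
qed (auto simp: augmentation_mult one_eq_delta)

sublocale S: ring S by (rule ring_group_ring)

sublocale aug: ring_hom_ring S R \<epsilon>
  by (intro ring_hom_ringI2 augmentation_hom ring_axioms ring_group_ring)

lemma coeff_neg [simp]:
  assumes "f \<in> carrier S" "g \<in> carrier G"
  shows "(\<ominus>\<^bsub>S\<^esub> f) g = \<ominus> f g"
proof -
  have "(\<ominus>\<^bsub>S\<^esub> f \<oplus>\<^bsub>S\<^esub> f) g = \<zero>" using assms by (simp add: S.l_neg)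
  then show ?thesis using assms minus_equality [of "(\<ominus>\<^bsub>S\<^esub> f) g" "f g"] by simp
qed

lemma delta_mult:
  assumes "s \<in> carrier G" "t \<in> carrier G"
  shows "\<delta> s \<otimes>\<^bsub>S\<^esub> \<delta> t = \<delta> (s \<otimes>\<^bsub>G\<^esub> t)"
proof (rule group_ring_eqI)
  fix g assume g: "g \<in> carrier G"
  have "inv\<^bsub>G\<^esub> s \<otimes>\<^bsub>G\<^esub> g = t \<longleftrightarrow> g = s \<otimes>\<^bsub>G\<^esub> t" using assms g by (metis G.inv_solve_left)
  then show "(\<delta> s \<otimes>\<^bsub>S\<^esub> \<delta> t) g = \<delta> (s \<otimes>\<^bsub>G\<^esub> t) g" using assms g by (simp add: coeff_delta_mult)
qed (use assms in auto)

subsection \<open>Units of the group ring\<close>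

lemma supported_on_iff:
  "f \<in> supported_on R G K \<longleftrightarrow> f \<in> carrier S \<and> (\<forall>g\<in>carrier G. g \<notin> K \<longrightarrow> f g = \<zero>)"
  by (auto simp: supported_on_def group_ring_supp_def)

lemma subring_supported_on:
  assumes K: "subgroup K G"
  shows "subring (supported_on R G K) S"
proof (rule S.subringI)
  show "supported_on R G K \<subseteq> carrier S" by (auto simp: supported_on_def)
  show "\<one>\<^bsub>S\<^esub> \<in> supported_on R G K"
    using subgroup.one_closed [OF K] by (auto simp: supported_on_iff one_eq_delta)
  fix f assume f: "f \<in> supported_on R G K"
  then show "\<ominus>\<^bsub>S\<^esub> f \<in> supported_on R G K" by (auto simp: supported_on_iff)
  fix h assume h: "h \<in> supported_on R G K"
  with f show "f \<oplus>\<^bsub>S\<^esub> h \<in> supported_on R G K" by (auto simp: supported_on_iff)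
  have "supp f <#>\<^bsub>G\<^esub> supp h \<subseteq> K"
    using f h K by (auto simp: supported_on_def set_mult_def subgroup.m_closed subset_eq)
  with f h show "f \<otimes>\<^bsub>S\<^esub> h \<in> supported_on R G K"
    using supp_mult [of f h] by (auto simp: supported_on_def)
qed

text \<open>Over the trivial subgroup the subring is a copy of \<open>R\<close> via the coefficient
  at the identity, and the augmentation is exactly that coefficient. Placing its inverse at the
  identity gives the inverse of \<open>f\<close>.\<close>

lemma Units_supported_on_trivial:
  assumes f: "f \<in> supported_on R G {\<one>\<^bsub>G\<^esub>}" "\<epsilon> f \<in> Units R"
  shows "f \<in> Units (S\<lparr>carrier := supported_on R G {\<one>\<^bsub>G\<^esub>}\<rparr>)"
proof -
  let ?A = "supported_on R G {\<one>\<^bsub>G\<^esub>}"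
  have mult: "h \<otimes>\<^bsub>S\<^esub> k = \<one>\<^bsub>S\<^esub>" if hk: "h \<in> ?A" "k \<in> ?A" and inv: "h \<one>\<^bsub>G\<^esub> \<otimes> k \<one>\<^bsub>G\<^esub> = \<one>" for h k
  proof (rule group_ring_eqI)
    fix g assume g: "g \<in> carrier G"
    have "(h \<otimes>\<^bsub>S\<^esub> k) g = (\<Oplus>x\<in>{\<one>\<^bsub>G\<^esub>}. h x \<otimes> k (inv\<^bsub>G\<^esub> x \<otimes>\<^bsub>G\<^esub> g))"
      using hk g by (intro coeff_mult) (auto simp: supported_on_def)
    also have "\<dots> = h \<one>\<^bsub>G\<^esub> \<otimes> k g" using hk g by (simp add: supported_on_iff)
    also have "\<dots> = \<one>\<^bsub>S\<^esub> g" using hk g inv by (auto simp: supported_on_iff one_eq_delta)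
    finally show "(h \<otimes>\<^bsub>S\<^esub> k) g = \<one>\<^bsub>S\<^esub> g" .
  qed (use hk in \<open>auto simp: supported_on_iff\<close>)
  have fS: "f \<in> carrier S" using f by (simp add: supported_on_iff)
  have ef: "\<epsilon> f = f \<one>\<^bsub>G\<^esub>"
    using f fS augmentation_eq [of f "{\<one>\<^bsub>G\<^esub>}"] by (simp add: supported_on_def)
  then obtain r where r: "r \<in> carrier R" "f \<one>\<^bsub>G\<^esub> \<otimes> r = \<one>" "r \<otimes> f \<one>\<^bsub>G\<^esub> = \<one>"
    using f(2) by (auto simp: Units_def)
  let ?h = "\<lambda>g\<in>carrier G. if g = \<one>\<^bsub>G\<^esub> then r else \<zero>"
  have hS: "?h \<in> carrier S"
    by (rule group_ring_carrierI [of _ "{\<one>\<^bsub>G\<^esub>}"]) (use r in \<open>auto split: if_splits\<close>)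
  then have h: "?h \<in> ?A" by (auto simp: supported_on_iff)
  have "f \<otimes>\<^bsub>S\<^esub> ?h = \<one>\<^bsub>S\<^esub>" "?h \<otimes>\<^bsub>S\<^esub> f = \<one>\<^bsub>S\<^esub>" using mult f(1) h r by auto
  with f(1) h show ?thesis unfolding Units_def by auto
qed

text \<open>Invertibility is claimed inside the subring over \<open>H\<close>, not merely in
  \<open>S\<close>. The induction hypothesis for \<open>K\<close> is then precisely the assumption
  \<open>lift\<close> of \<open>Units_lift_index_two\<close>, which needs inverses in the smaller
  ring.\<close>

lemma Units_supported_on:
  assumes two: "\<And>x. x \<in> carrier R \<Longrightarrow> \<one> \<ominus> (x \<oplus> x) \<in> Units R"
    and "subgroup H G" "card H = 2 ^ n" "f \<in> supported_on R G H" "\<epsilon> f \<in> Units R"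
  shows "f \<in> Units (S\<lparr>carrier := supported_on R G H\<rparr>)"
  using assms(2-)
proof (induction n arbitrary: H f)
  case 0
  have "\<one>\<^bsub>G\<^esub> \<in> H" using 0(1) by (rule subgroup.one_closed)
  with 0(2) have "H = {\<one>\<^bsub>G\<^esub>}" by (metis card_1_singletonE power_0 singletonD)
  then show ?case using 0 Units_supported_on_trivial by simp
next
  case (Suc n)
  note H = Suc.prems(1)
  have fin: "finite H" using Suc.prems(2) by (simp add: card_ge_0_finite)
  \<comment> \<open>The order of \<open>H\<close> is read as \<open>2 ^ n * 2\<close>. The cofactor
    in \<open>sylow_thm\<close> may share the prime 2, so the theorem yields a subgroup of index
    2.\<close>
  obtain K where K': "subgroup K (G\<lparr>carrier := H\<rparr>)" "card K = 2 ^ n"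
    using sylow_thm [OF two_is_prime_nat G.subgroup_imp_group [OF H], of n 2] fin Suc.prems(2) by (auto simp: order_def)
  then have K: "subgroup K G" "K \<subseteq> H"
    using G.incl_subgroup [OF H] subgroup.subset [OF K'(1)] by auto
  have "card H = 2 * card K" using Suc.prems(2) K' by simp
  then obtain t where t: "t \<in> H" "t \<notin> K" "t \<otimes>\<^bsub>G\<^esub> t \<in> K"
    "\<And>h. h \<in> H \<Longrightarrow> h \<in> K \<or> h \<otimes>\<^bsub>G\<^esub> inv\<^bsub>G\<^esub> t \<in> K"
    "\<And>k. k \<in> K \<Longrightarrow> t \<otimes>\<^bsub>G\<^esub> k \<otimes>\<^bsub>G\<^esub> inv\<^bsub>G\<^esub> t \<in> K"
    using G.index_two_transversal [OF H fin K] by blast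
  have Hc: "h \<in> carrier G" if "h \<in> H" for h using subgroup.mem_carrier [OF H that] .
  have Kc: "k \<in> carrier G" if "k \<in> K" for k using that K(2) Hc by blast
  note tc = Hc [OF t(1)]
  let ?A = "supported_on R G K"
  let ?T = "S\<lparr>carrier := supported_on R G H\<rparr>"
  have TS: "supported_on R G H \<subseteq> carrier S" by (auto simp: supported_on_def)
  have AT: "?A \<subseteq> supported_on R G H" using K(2) by (auto simp: supported_on_def)
  interpret T: ring ?T using S.subring_is_ring [OF subring_supported_on [OF H]] .
  show ?case
  proof (rule Units_lift_index_two [where T = ?T and R = R and e = \<epsilon> and A = ?A and t = "\<delta> t"])
    show "ring ?T" by (rule T.ring_axioms)
    show "ring R" by (rule ring_axioms)
    show "\<epsilon> \<in> ring_hom ?T R" using TS by (intro ring_hom_memI) (auto simp: subset_eq)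
    show "subring ?A ?T"
      using S.subring_is_ring [OF subring_supported_on [OF K(1)]] AT
      by (intro T.ring_incl_imp_subring) auto
    show "\<delta> t \<in> carrier ?T" using t(1) by (auto simp: supported_on_iff)
    show "\<epsilon> (\<delta> t) = \<one>" using tc by simp
    show "\<delta> t \<otimes>\<^bsub>?T\<^esub> \<delta> t \<in> ?A" using tc t(3) by (auto simp: delta_mult supported_on_iff)
    show "f \<in> carrier ?T" "\<epsilon> f \<in> Units R" using Suc.prems by auto
    show "a \<in> Units (?T\<lparr>carrier := ?A\<rparr>)" if "a \<in> ?A" "\<epsilon> a \<in> Units R" for a
      using Suc.IH [OF K(1) K'(2) that] by simp
  next
    fix a assume a: "a \<in> ?A"
    then have aS: "a \<in> carrier S" by (simp add: supported_on_iff)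
    \<comment> \<open>The required \<open>a'\<close> is the conjugate of \<open>a\<close> by
      \<open>t\<close>. Its coefficient at g is that of \<open>a\<close> at t^-1 g t, which lies
      outside \<open>K\<close> whenever g does, because conjugation by \<open>t\<close> maps
      \<open>K\<close> into itself.\<close>
    let ?a = "\<delta> t \<otimes>\<^bsub>S\<^esub> a \<otimes>\<^bsub>S\<^esub> \<delta> (inv\<^bsub>G\<^esub> t)"
    have "?a g = \<zero>" if g: "g \<in> carrier G" "g \<notin> K" for g
    proof -
      let ?k = "inv\<^bsub>G\<^esub> t \<otimes>\<^bsub>G\<^esub> (g \<otimes>\<^bsub>G\<^esub> t)"
      have "t \<otimes>\<^bsub>G\<^esub> ?k \<otimes>\<^bsub>G\<^esub> inv\<^bsub>G\<^esub> t = g" using g tc by (simp add: G.m_assoc [symmetric]) (simp add: G.m_assoc)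
      then have "?k \<notin> K" using t(5) g(2) by metis
      then show ?thesis using a aS tc g by (simp add: coeff_mult_delta coeff_delta_mult supported_on_iff)
    qed
    then have "?a \<in> ?A" using aS by (simp add: supported_on_iff)
    moreover have "\<delta> t \<otimes>\<^bsub>S\<^esub> a = ?a \<otimes>\<^bsub>S\<^esub> \<delta> t"
      using aS tc by (simp add: S.m_assoc delta_mult one_eq_delta [symmetric])
    ultimately show "\<exists>a'\<in>?A. \<delta> t \<otimes>\<^bsub>?T\<^esub> a = a' \<otimes>\<^bsub>?T\<^esub> \<delta> t" by auto
  next
    fix f assume "f \<in> carrier ?T"
    then have f: "f \<in> carrier S" "\<And>g. g \<in> carrier G \<Longrightarrow> g \<notin> H \<Longrightarrow> f g = \<zero>" by (auto simp: supported_on_iff)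
    \<comment> \<open>The element \<open>f\<close> is split along the cosets \<open>K\<close> and
      \<open>K t\<close>: right multiplication by \<open>t\<close> moves the coefficient of
      \<open>?b\<close> at k to kt, so \<open>?b\<close> must take the value f(kt) at k.\<close>
    let ?a = "\<lambda>g\<in>carrier G. if g \<in> K then f g else \<zero>"
    let ?b = "\<lambda>g\<in>carrier G. if g \<in> K then f (g \<otimes>\<^bsub>G\<^esub> t) else \<zero>"
    have fK: "finite K" using K(2) fin finite_subset by blast
    have ab: "?a \<in> carrier S" "?b \<in> carrier S"
      by (rule group_ring_carrierI [OF _ fK]; use f tc in \<open>auto split: if_splits\<close>)+
    have "f = ?a \<oplus>\<^bsub>S\<^esub> ?b \<otimes>\<^bsub>S\<^esub> \<delta> t"
    proof (rule group_ring_eqI)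
      fix g assume g: "g \<in> carrier G"
      \<comment> \<open>The cosets are disjoint, so at most one of the two summands contributes at
        \<open>g\<close> and no coefficient is counted twice.\<close>
      have "\<not> (g \<in> K \<and> g \<otimes>\<^bsub>G\<^esub> inv\<^bsub>G\<^esub> t \<in> K)"
      proof
        assume gK: "g \<in> K \<and> g \<otimes>\<^bsub>G\<^esub> inv\<^bsub>G\<^esub> t \<in> K"
        then have "inv\<^bsub>G\<^esub> (g \<otimes>\<^bsub>G\<^esub> inv\<^bsub>G\<^esub> t) \<otimes>\<^bsub>G\<^esub> g \<in> K"
          using K(1) by (simp add: subgroup.m_closed subgroup.m_inv_closed)
        then show False using g tc t(2) by (simp add: G.inv_mult_group G.m_assoc)
      qed
      then show "f g = (?a \<oplus>\<^bsub>S\<^esub> ?b \<otimes>\<^bsub>S\<^esub> \<delta> t) g"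
        using f(1) f(2) [of g] t(4) [of g] g tc ab by (auto simp: coeff_mult_delta G.m_assoc)
    qed (use f ab in auto)
    moreover have "?a \<in> ?A" "?b \<in> ?A" using ab by (auto simp: supported_on_iff)
    ultimately show "\<exists>a\<in>?A. \<exists>b\<in>?A. f = a \<oplus>\<^bsub>?T\<^esub> b \<otimes>\<^bsub>?T\<^esub> \<delta> t" by auto
  qed (use two in auto)
qed

lemma Units_group_ring_if_augmentation:
  assumes two: "\<And>x. x \<in> carrier R \<Longrightarrow> \<one> \<ominus> (x \<oplus> x) \<in> Units R"
    and G: "locally_finite_group G" "two_group G"
    and f: "f \<in> carrier S" "\<epsilon> f \<in> Units R"
  shows "f \<in> Units S"
proof -
  let ?H = "generate G (supp f)"
  have H: "subgroup ?H G" using G.generate_is_subgroup supp_subset by blast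
  have "finite ?H" using G(1) f(1) supp_subset by (simp add: locally_finite_group_def)
  then obtain n :: nat where "card ?H = 2 ^ n" using G.two_group_card_subgroup [OF G(2) H] by blast
  moreover have "f \<in> supported_on R G ?H" using f(1) by (auto simp: supported_on_def intro: generate.incl)
  ultimately have "f \<in> Units (S\<lparr>carrier := supported_on R G ?H\<rparr>)"
    using Units_supported_on [OF two H] f(2) by blast
  \<comment> \<open>The subring has the same identity and product as \<open>S\<close>, so an inverse
    found there is an inverse in \<open>S\<close>.\<close>
  then show ?thesis by (auto simp: Units_def supported_on_def)
qed

end

theorem proposition4p6:
  fixes R :: "('a, 'm) ring_scheme"
    and G :: "('g, 'n) monoid_scheme"
  assumes "UQ_ring R" and "locally_finite_group G" and "two_group G"
  shows "UQ_ring (group_ring R G)"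
proof -
  interpret ring_and_group R G
    using assms by (simp add: UQ_ring_def two_group_def ring_and_group_def)
  show ?thesis
    using Units_group_ring_if_augmentation [OF UQ_ring_two_in_radical [OF assms(1)] assms(2,3)]
    by (rule UQ_ring_lift [OF ring_group_ring assms(1) augmentation_hom])
qed

end
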